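(* Let $\theta>0$ and let $X$ be a (real-valued) random variable. Then the following properties are equivalent: \begin{enumerate} \item The tails of $X$ satisfy: there exists $K_1>0$ such that $$\mathbb{P}(|X|\ge x)\le 2\exp\left(-(x/K_1)^{1/\theta}\right)\quad\text{for all } x\ge 0.$$ \item The moments of $X$ satisfy: there exists $K_2>0$ such that $$\|X\|_k\le K_2\,k^{\theta}\quad\text{for all real } k\ge 1.$$ \item The moment generating function of $|X|^{1/\theta}$ satisfies: there exists $K_3>0$ such that $$\mathbb{E}\left[\exp\left((\lambda|X|)^{1/\theta}\right)\right]\le \exp\left((\lambda K_3)^{1/\theta}\right)\quad\text{for all }\lambda\text{ such that } 0<\lambda\le 1/K_3.$$ \item The moment generating function of $|X|^{1/\theta}$ is bounded at some point, namely there exists $K_4>0$ such that $$\mathbb{E}\left[\exp\left((|X|/K_4)^{1/\theta}\right)\right]\le 2.$$ \end{enumerate}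
   Context: For a real random variable $X$ and $k\ge 1$ such that the $k$-th moment of $X$ exists, $\|X\|_k=\left(\mathbb{E}[|X|^k]\right)^{1/k}$. An inequality $\|X\|_k\le c$ with $c$ finite includes the assertion that $\mathbb{E}[|X|^k]<\infty$. *)

theory Defs
  imports "HOL-Probability.Probability"
begin

text \<open>The norm is only meaningful if the k-th absolute moment is finite (the Bochner integral of a
  non-integrable function is 0), so integrability is always stated alongside bounds on
  expectations below.\<close>

definition moment_norm :: "'a measure \<Rightarrow> ('a \<Rightarrow> real) \<Rightarrow> real \<Rightarrow> real" where
  "moment_norm M X k = (\<integral>\<omega>. \<bar>X \<omega>\<bar> powr k \<partial>M) powr (1 / k)"

definition tail_bound :: "'a measure \<Rightarrow> ('a \<Rightarrow> real) \<Rightarrow> real \<Rightarrow> bool" where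
  "tail_bound M X \<theta> \<longleftrightarrow>
    (\<exists>K>0. \<forall>x\<ge>0.
      measure M {\<omega> \<in> space M. \<bar>X \<omega>\<bar> \<ge> x} \<le> 2 * exp (- ((x / K) powr (1 / \<theta>))))"

definition moment_bound :: "'a measure \<Rightarrow> ('a \<Rightarrow> real) \<Rightarrow> real \<Rightarrow> bool" where
  "moment_bound M X \<theta> \<longleftrightarrow>
    (\<exists>K>0. \<forall>k\<ge>1.
      integrable M (\<lambda>\<omega>. \<bar>X \<omega>\<bar> powr k) \<and> moment_norm M X k \<le> K * k powr \<theta>)"

definition mgf_bound_near_zero :: "'a measure \<Rightarrow> ('a \<Rightarrow> real) \<Rightarrow> real \<Rightarrow> bool" where
  "mgf_bound_near_zero M X \<theta> \<longleftrightarrow>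
    (\<exists>K>0. \<forall>t. 0 < t \<and> t \<le> 1 / K \<longrightarrow>
      integrable M (\<lambda>\<omega>. exp ((t * \<bar>X \<omega>\<bar>) powr (1 / \<theta>))) \<and>
      (\<integral>\<omega>. exp ((t * \<bar>X \<omega>\<bar>) powr (1 / \<theta>)) \<partial>M) \<le> exp ((t * K) powr (1 / \<theta>)))"

definition mgf_bound_at_point :: "'a measure \<Rightarrow> ('a \<Rightarrow> real) \<Rightarrow> real \<Rightarrow> bool" where
  "mgf_bound_at_point M X \<theta> \<longleftrightarrow>
    (\<exists>K>0.
      integrable M (\<lambda>\<omega>. exp ((\<bar>X \<omega>\<bar> / K) powr (1 / \<theta>))) \<and>
      (\<integral>\<omega>. exp ((\<bar>X \<omega>\<bar> / K) powr (1 / \<theta>)) \<partial>M) \<le> 2)"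

end

theory Submission
  imports Defs
begin

text \<open>
  All four properties say that \<open>Y = \<bar>X\<bar> powr (1 / \<theta>)\<close> has a finite exponential moment:
  \<open>exp (s * Y)\<close> is integrable for some \<open>s > 0\<close>, with no prescribed bound on the integral.
  This weak condition, called \<open>exp_moment\<close> below, is the hub of the proof.

  The constants required by the two bounds on the moment generating function are free: by Jensen's
  inequality, \<open>ln E[exp (t * Y)] / t\<close> is nondecreasing in \<open>t\<close>, so one finite value at \<open>s\<close> forces
  \<open>E[exp (t * Y)] \<le> exp (t * c)\<close> for all \<open>0 \<le> t \<le> s\<close> with \<open>c = ln E[exp (s * Y)] / s\<close>
  (\<open>integral_exp_scaled_le\<close>), and this is at most 2 once \<open>t\<close> is small.

  Tails and moments are linked to the hub in a cycle. An exponential tail of rate \<open>a\<close> makes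
  \<open>exp (s * Y)\<close> integrable for \<open>s < a\<close>, by cutting the range of \<open>Y\<close> into unit intervals and
  summing a geometric series (\<open>integrable_exp_of_exponential_tail\<close>). The elementary inequality
  \<open>y powr p \<le> (p / s) powr p * exp (s * y)\<close> with \<open>p = \<theta> * k\<close> turns an exponential moment into
  moments of order \<open>k\<close> growing like \<open>k powr \<theta>\<close>. Finally Markov's inequality gives back the tail at
  \<open>x\<close>, applied to a moment whose order \<open>k\<close> is proportional to \<open>x powr (1 / \<theta>)\<close>. Since all real
  orders \<open>k \<ge> 1\<close> are admitted, no rounding is needed.
\<close>

definition exp_moment :: "'a measure \<Rightarrow> ('a \<Rightarrow> real) \<Rightarrow> real \<Rightarrow> bool" where
  "exp_moment M X \<theta> \<longleftrightarrow> (\<exists>s>0. integrable M (\<lambda>\<omega>. exp (s * \<bar>X \<omega>\<bar> powr (1 / \<theta>))))"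

text \<open>
  On the event \<open>n \<le> Y < n + 1\<close> the function \<open>exp (s * Y)\<close> is at most \<open>exp (s * (n + 1))\<close>, and the
  probability of this event decays at the faster rate \<open>a\<close>.
\<close>

lemma (in prob_space) integrable_exp_of_exponential_tail:
  fixes Y :: "'a \<Rightarrow> real"
  assumes Y [measurable]: "Y \<in> borel_measurable M"
    and nonneg: "\<And>\<omega>. Y \<omega> \<ge> 0"
    and s: "0 \<le> s" "s < a"
    and tail: "\<And>n::nat. prob {\<omega> \<in> space M. Y \<omega> \<ge> real n} \<le> C * exp (- (a * real n))"
  shows "integrable M (\<lambda>\<omega>. exp (s * Y \<omega>))"
proof (rule integrableI_bounded)
  define A where "A n = {\<omega> \<in> space M. Y \<omega> \<ge> real n}" for n :: nat
  define b where "b n = exp (s * (real n + 1)) * (C * exp (- (a * real n)))" for n :: nat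
  have A [measurable]: "A n \<in> sets M" for n
    unfolding A_def by measurable
  have b_nonneg: "b n \<ge> 0" for n
    unfolding b_def using order_trans[OF measure_nonneg tail[of n]] by simp
  have b_geometric: "b n = (C * exp s) * exp (s - a) ^ n" for n
    by (simp add: b_def exp_of_nat_mult[symmetric] mult_exp_exp algebra_simps)
  have "summable (\<lambda>n. exp (s - a) ^ n)"
    using s by (intro summable_geometric) simp
  then have "summable b"
    unfolding b_geometric[abs_def] by (rule summable_mult)
  have "(\<integral>\<^sup>+\<omega>. ennreal (norm (exp (s * Y \<omega>))) \<partial>M)
      \<le> (\<integral>\<^sup>+\<omega>. (\<Sum>n. ennreal (exp (s * (real n + 1))) * indicator (A n) \<omega>) \<partial>M)"
  proof (rule nn_integral_mono)
    fix \<omega> assume \<omega>: "\<omega> \<in> space M"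
    define N where "N = nat \<lfloor>Y \<omega>\<rfloor>"
    have N: "real N \<le> Y \<omega>" "Y \<omega> \<le> real N + 1"
      unfolding N_def using nonneg[of \<omega>] by (simp_all add: of_nat_floor)
    have "ennreal (norm (exp (s * Y \<omega>))) \<le> ennreal (exp (s * (real N + 1)))"
      using s(1) N(2) by (simp add: mult_left_mono ennreal_leI)
    also have "\<dots> = (\<Sum>n\<in>{N}. ennreal (exp (s * (real n + 1))) * indicator (A n) \<omega>)"
      using N(1) \<omega> by (simp add: A_def)
    also have "\<dots> \<le> (\<Sum>n. ennreal (exp (s * (real n + 1))) * indicator (A n) \<omega>)"
      by (rule sum_le_suminf) auto
    finally show "ennreal (norm (exp (s * Y \<omega>)))
        \<le> (\<Sum>n. ennreal (exp (s * (real n + 1))) * indicator (A n) \<omega>)" .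
  qed
  also have "\<dots> = (\<Sum>n. ennreal (exp (s * (real n + 1))) * emeasure M (A n))"
    by (simp add: nn_integral_suminf nn_integral_cmult)
  also have "\<dots> \<le> (\<Sum>n. ennreal (b n))"
  proof (intro suminf_le allI)
    fix n
    have "exp (s * (real n + 1)) * prob (A n) \<le> b n"
      unfolding b_def A_def by (intro mult_left_mono tail) simp
    then show "ennreal (exp (s * (real n + 1))) * emeasure M (A n) \<le> ennreal (b n)"
      by (simp add: emeasure_eq_measure ennreal_mult[symmetric] ennreal_leI)
  qed auto
  also have "\<dots> < \<infinity>"
    using ennreal_suminf_neq_top[OF \<open>summable b\<close> b_nonneg] by (simp add: less_top)
  finally show "(\<integral>\<^sup>+\<omega>. ennreal (norm (exp (s * Y \<omega>))) \<partial>M) < \<infinity>" .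
qed measurable

lemma tail_bound_imp_exp_moment:
  assumes "prob_space M" and X [measurable]: "X \<in> borel_measurable M" and \<theta>: "\<theta> > 0"
    and "tail_bound M X \<theta>"
  shows "exp_moment M X \<theta>"
proof -
  interpret prob_space M by fact
  obtain K where K: "K > 0"
    and tail: "\<And>x. x \<ge> 0 \<Longrightarrow>
      prob {\<omega> \<in> space M. \<bar>X \<omega>\<bar> \<ge> x} \<le> 2 * exp (- ((x / K) powr (1 / \<theta>)))"
    using assms(4) unfolding tail_bound_def by blast
  define a where "a = (1 / K) powr (1 / \<theta>)"
  have a: "a > 0"
    using K by (simp add: a_def)
  have "prob {\<omega> \<in> space M. \<bar>X \<omega>\<bar> powr (1 / \<theta>) \<ge> real n} \<le> 2 * exp (- (a * real n))" for n :: nat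
  proof -
    have "real n \<le> \<bar>X \<omega>\<bar> powr (1 / \<theta>) \<longleftrightarrow> real n powr \<theta> \<le> \<bar>X \<omega>\<bar>" for \<omega>
    proof
      assume "real n \<le> \<bar>X \<omega>\<bar> powr (1 / \<theta>)"
      from powr_mono2[OF _ _ this, of \<theta>] \<theta> show "real n powr \<theta> \<le> \<bar>X \<omega>\<bar>"
        by (simp add: powr_powr)
    next
      assume "real n powr \<theta> \<le> \<bar>X \<omega>\<bar>"
      from powr_mono2[OF _ _ this, of "1 / \<theta>"] \<theta> show "real n \<le> \<bar>X \<omega>\<bar> powr (1 / \<theta>)"
        by (simp add: powr_powr)
    qed
    moreover have "(real n powr \<theta> / K) powr (1 / \<theta>) = a * real n"
      using \<theta> K by (simp add: a_def powr_divide powr_powr)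
    ultimately show ?thesis
      using tail[of "real n powr \<theta>"] by simp
  qed
  then have "integrable M (\<lambda>\<omega>. exp (a / 2 * \<bar>X \<omega>\<bar> powr (1 / \<theta>)))"
    using a by (intro integrable_exp_of_exponential_tail[where a = a and C = 2]) auto
  then show ?thesis
    unfolding exp_moment_def using a by (intro exI[of _ "a / 2"]) simp
qed

text \<open>
  This is \<open>u \<le> exp u\<close> at \<open>u = s * y / p\<close>, raised to the power \<open>p\<close>.
\<close>

lemma powr_le_powr_times_exp:
  fixes y p s :: real
  assumes "y \<ge> 0" "p > 0" "s > 0"
  shows "y powr p \<le> (p / s) powr p * exp (s * y)"
proof -
  have "s * y / p \<le> exp (s * y / p)"
    using exp_ge_add_one_self[of "s * y / p"] by linarith
  then have "(s * y / p) powr p \<le> exp (s * y / p) powr p"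
    using assms by (intro powr_mono2) auto
  also have "\<dots> = exp (s * y)"
    using assms by (simp add: powr_def)
  finally have "(p / s) powr p * (s * y / p) powr p \<le> (p / s) powr p * exp (s * y)"
    by (intro mult_left_mono) auto
  moreover have "(p / s) powr p * (s * y / p) powr p = y powr p"
    using assms by (simp add: powr_mult[symmetric])
  ultimately show ?thesis by simp
qed

lemma exp_moment_imp_moment_bound:
  assumes "prob_space M" and X [measurable]: "X \<in> borel_measurable M" and \<theta>: "\<theta> > 0"
    and "exp_moment M X \<theta>"
  shows "moment_bound M X \<theta>"
proof -
  interpret prob_space M by fact
  obtain s where s: "s > 0" and int: "integrable M (\<lambda>\<omega>. exp (s * \<bar>X \<omega>\<bar> powr (1 / \<theta>)))"
    using assms(4) unfolding exp_moment_def by blast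
  define m where "m = expectation (\<lambda>\<omega>. exp (s * \<bar>X \<omega>\<bar> powr (1 / \<theta>)))"
  have "expectation (\<lambda>_. 1) \<le> m"
    unfolding m_def using s by (intro integral_mono int) auto
  then have m: "m \<ge> 1"
    by (simp add: prob_space)
  have "integrable M (\<lambda>\<omega>. \<bar>X \<omega>\<bar> powr k)
      \<and> moment_norm M X k \<le> ((\<theta> / s) powr \<theta> * m) * k powr \<theta>" if k: "k \<ge> 1" for k
  proof
    define c where "c = (\<theta> * k / s) powr (\<theta> * k)"
    have c: "c \<ge> 0"
      by (simp add: c_def)
    have pointwise: "\<bar>X \<omega>\<bar> powr k \<le> c * exp (s * \<bar>X \<omega>\<bar> powr (1 / \<theta>))" for \<omega>
      using powr_le_powr_times_exp[of "\<bar>X \<omega>\<bar> powr (1 / \<theta>)" "\<theta> * k" s] \<theta> s k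
      by (simp add: c_def powr_powr)
    show "integrable M (\<lambda>\<omega>. \<bar>X \<omega>\<bar> powr k)"
      by (rule Bochner_Integration.integrable_bound[OF integrable_mult_right[OF int, of c]])
        (use pointwise c in auto)
    then have "expectation (\<lambda>\<omega>. \<bar>X \<omega>\<bar> powr k)
        \<le> expectation (\<lambda>\<omega>. c * exp (s * \<bar>X \<omega>\<bar> powr (1 / \<theta>)))"
      using int pointwise by (intro integral_mono) auto
    also have "\<dots> = c * m"
      by (simp add: m_def)
    finally have "moment_norm M X k \<le> (c * m) powr (1 / k)"
      unfolding moment_norm_def using k by (intro powr_mono2) auto
    also have "\<dots> = ((\<theta> / s) powr \<theta> * k powr \<theta>) * m powr (1 / k)"
    proof -
      have "c powr (1 / k) = (\<theta> * k / s) powr \<theta>"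
        using k by (simp add: c_def powr_powr)
      also have "\<dots> = (\<theta> / s) powr \<theta> * k powr \<theta>"
        using k s \<theta> powr_mult[of "\<theta> / s" k \<theta>] by simp
      finally show ?thesis
        using c m by (simp add: powr_mult)
    qed
    also have "\<dots> \<le> ((\<theta> / s) powr \<theta> * k powr \<theta>) * m"
    proof -
      have "m powr (1 / k) \<le> m powr 1"
        using k m by (intro powr_mono) auto
      then show ?thesis
        using m by (intro mult_left_mono) auto
    qed
    finally show "moment_norm M X k \<le> ((\<theta> / s) powr \<theta> * m) * k powr \<theta>"
      by (simp add: mult_ac)
  qed
  moreover have "(\<theta> / s) powr \<theta> * m > 0"
    using \<theta> s m by simp
  ultimately show ?thesis
    unfolding moment_bound_def by blast
qed

text \<open>
  Markov's inequality bounds the tail at \<open>x > 0\<close> by \<open>(K * k powr \<theta> / x) powr k\<close> for every \<open>k \<ge> 1\<close>. The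
  choice of \<open>k\<close> with \<open>K * k powr \<theta> = x / e\<close> makes this \<open>exp (-k)\<close>. For small \<open>x\<close> this \<open>k\<close> falls
  below 1 and is not an admissible order, but then the trivial bound 1 suffices: halving the
  exponent, at the price of a factor \<open>2 powr \<theta>\<close> in the constant, leaves
  \<open>2 * exp (- k / 2) \<ge> 2 * exp (- 1 / 2) \<ge> 1\<close>.
\<close>

lemma moment_bound_imp_tail_bound:
  assumes "prob_space M" and X [measurable]: "X \<in> borel_measurable M" and \<theta>: "\<theta> > 0"
    and "moment_bound M X \<theta>"
  shows "tail_bound M X \<theta>"
proof -
  interpret prob_space M by fact
  obtain K where K: "K > 0"
    and int: "\<And>k. k \<ge> 1 \<Longrightarrow> integrable M (\<lambda>\<omega>. \<bar>X \<omega>\<bar> powr k)"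
    and norm: "\<And>k. k \<ge> 1 \<Longrightarrow> moment_norm M X k \<le> K * k powr \<theta>"
    using assms(4) unfolding moment_bound_def by blast
  define L where "L = exp 1 * K"
  have L: "L > 0"
    using K by (simp add: L_def)
  have "prob {\<omega> \<in> space M. \<bar>X \<omega>\<bar> \<ge> x} \<le> 2 * exp (- ((x / (L * 2 powr \<theta>)) powr (1 / \<theta>)))"
    if x: "x \<ge> 0" for x
  proof -
    define k where "k = (x / L) powr (1 / \<theta>)"
    have k_nonneg: "k \<ge> 0"
      by (simp add: k_def)
    have half: "(x / (L * 2 powr \<theta>)) powr (1 / \<theta>) = k / 2"
      using x L \<theta> powr_divide[of "x / L" "2 powr \<theta>" "1 / \<theta>"] by (simp add: k_def powr_powr)
    have "prob {\<omega> \<in> space M. \<bar>X \<omega>\<bar> \<ge> x} \<le> 2 * exp (- (k / 2))"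
    proof (cases "k \<ge> 1")
      case False
      have "(1::real) \<le> 2 * exp (- (1 / 2))"
        using exp_half_le2 by (simp add: exp_minus field_simps)
      also have "\<dots> \<le> 2 * exp (- (k / 2))"
        using False by simp
      finally show ?thesis
        using prob_le_1 order_trans by blast
    next
      case True
      then have "x \<noteq> 0"
        by (auto simp: k_def)
      with x have x_pos: "x > 0"
        by simp
      have "k powr \<theta> = x / L"
        using x L \<theta> by (simp add: k_def powr_powr)
      then have order: "K * k powr \<theta> = x / exp 1"
        using K by (simp add: L_def)
      have "expectation (\<lambda>\<omega>. \<bar>X \<omega>\<bar> powr k) = moment_norm M X k powr k"
        using True by (simp add: moment_norm_def powr_powr)
      also have "\<dots> \<le> (K * k powr \<theta>) powr k"
        using norm[OF True] True by (intro powr_mono2) (auto simp: moment_norm_def)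
      also have "\<dots> = x powr k * exp (- k)"
        using x_pos unfolding order by (simp add: powr_divide exp_powr_real exp_minus field_simps)
      finally have moment: "expectation (\<lambda>\<omega>. \<bar>X \<omega>\<bar> powr k) \<le> x powr k * exp (- k)" .
      have "prob {\<omega> \<in> space M. \<bar>X \<omega>\<bar> \<ge> x} \<le> prob {\<omega> \<in> space M. \<bar>X \<omega>\<bar> powr k \<ge> x powr k}"
        using x k_nonneg by (intro finite_measure_mono) (auto intro!: powr_mono2)
      also have "\<dots> \<le> expectation (\<lambda>\<omega>. \<bar>X \<omega>\<bar> powr k) / x powr k"
        using x_pos by (intro integral_Markov_inequality_measure[where A = "{}"] int True) auto
      also have "\<dots> \<le> exp (- k)"
        using moment x_pos by (simp add: field_simps)
      also have "\<dots> \<le> exp (- (k / 2))"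
        using k_nonneg by simp
      also have "\<dots> \<le> 2 * exp (- (k / 2))"
        by simp
      finally show ?thesis .
    qed
    then show ?thesis
      by (simp only: half)
  qed
  moreover have "L * 2 powr \<theta> > 0"
    using L by simp
  ultimately show ?thesis
    unfolding tail_bound_def by blast
qed

text \<open>
  Jensen's inequality for the concave function \<open>z \<mapsto> z powr (t / s)\<close>. With \<open>m\<close> the expectation of
  \<open>exp (s * Y)\<close> and \<open>b = ln m\<close>, convexity of \<open>exp\<close> on the segment from \<open>b\<close> to \<open>s * Y\<close> provides the
  supporting line that is then integrated.
\<close>

lemma (in prob_space) integral_exp_scaled_le:
  fixes Y :: "'a \<Rightarrow> real"
  assumes Y [measurable]: "Y \<in> borel_measurable M"
    and t: "0 \<le> t" "t \<le> s" "0 < s"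
    and int: "integrable M (\<lambda>\<omega>. exp (s * Y \<omega>))"
  shows "integrable M (\<lambda>\<omega>. exp (t * Y \<omega>))"
    and "expectation (\<lambda>\<omega>. exp (t * Y \<omega>))
      \<le> exp (t * (ln (expectation (\<lambda>\<omega>. exp (s * Y \<omega>))) / s))"
proof -
  define m where "m = expectation (\<lambda>\<omega>. exp (s * Y \<omega>))"
  define b where "b = ln m"
  define u where "u = t / s"
  have u: "0 \<le> u" "u \<le> 1" "u * s = t"
    using t by (auto simp: u_def)
  have "m > 0"
    unfolding m_def using int by (intro expectation_greater) auto
  then have exp_b: "exp b = m"
    by (simp add: b_def)
  have pointwise: "exp (t * Y \<omega>) \<le> exp ((u - 1) * b) * (u * exp (s * Y \<omega>) + (1 - u) * m)" for \<omega>
  proof -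
    have "exp ((1 - u) * b + u * (s * Y \<omega>)) \<le> (1 - u) * exp b + u * exp (s * Y \<omega>)"
      using convex_onD[OF exp_convex, of u b "s * Y \<omega>"] u by simp
    then have "exp ((u - 1) * b) * exp ((1 - u) * b + u * (s * Y \<omega>))
        \<le> exp ((u - 1) * b) * ((1 - u) * exp b + u * exp (s * Y \<omega>))"
      by (rule mult_left_mono) simp
    moreover have "(u - 1) * b + ((1 - u) * b + u * (s * Y \<omega>)) = t * Y \<omega>"
      using u(3) by (simp add: algebra_simps flip: u(3))
    ultimately show ?thesis
      by (simp add: mult_exp_exp exp_b add.commute)
  qed
  have int_line: "integrable M (\<lambda>\<omega>. exp ((u - 1) * b) * (u * exp (s * Y \<omega>) + (1 - u) * m))"
    using int by auto
  show int_t: "integrable M (\<lambda>\<omega>. exp (t * Y \<omega>))"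
    by (rule Bochner_Integration.integrable_bound[OF int_line])
      (auto intro!: order_trans[OF pointwise abs_ge_self])
  have "expectation (\<lambda>\<omega>. exp (t * Y \<omega>))
      \<le> expectation (\<lambda>\<omega>. exp ((u - 1) * b) * (u * exp (s * Y \<omega>) + (1 - u) * m))"
    using pointwise by (intro integral_mono int_t int_line) auto
  also have "\<dots> = exp ((u - 1) * b) * (u * m + (1 - u) * m)"
    using int by (simp add: m_def prob_space)
  also have "\<dots> = exp ((u - 1) * b) * exp b"
    by (simp add: exp_b algebra_simps)
  also have "\<dots> = exp (t * (b / s))"
    by (simp add: mult_exp_exp u_def algebra_simps)
  finally show "expectation (\<lambda>\<omega>. exp (t * Y \<omega>))
      \<le> exp (t * (ln (expectation (\<lambda>\<omega>. exp (s * Y \<omega>))) / s))"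
    by (simp add: b_def m_def)
qed

text \<open>
  The parameter \<open>t\<close> of \<open>mgf_bound_near_zero\<close> corresponds to the rate \<open>t powr (1 / \<theta>)\<close> in front of
  \<open>Y\<close>, and its constant \<open>K\<close> to \<open>c = K powr (1 / \<theta>)\<close>. So \<open>c\<close> has to dominate both the slope
  supplied by Jensen's inequality and \<open>1 / s\<close>, the latter because \<open>t \<le> 1 / K\<close> must keep the
  rate below \<open>s\<close>.
\<close>

lemma exp_moment_imp_mgf_bound_near_zero:
  assumes "prob_space M" and X [measurable]: "X \<in> borel_measurable M" and \<theta>: "\<theta> > 0"
    and "exp_moment M X \<theta>"
  shows "mgf_bound_near_zero M X \<theta>"
proof -
  interpret prob_space M by fact
  obtain s where s: "s > 0" and int: "integrable M (\<lambda>\<omega>. exp (s * \<bar>X \<omega>\<bar> powr (1 / \<theta>)))"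
    using assms(4) unfolding exp_moment_def by blast
  define d where "d = ln (expectation (\<lambda>\<omega>. exp (s * \<bar>X \<omega>\<bar> powr (1 / \<theta>)))) / s"
  define c where "c = max (1 / s) d"
  have c: "c > 0" "1 / s \<le> c" "d \<le> c"
    using s by (auto simp: c_def less_max_iff_disj)
  define K where "K = c powr \<theta>"
  have K: "K > 0" "K powr (1 / \<theta>) = c"
    using c \<theta> by (auto simp: K_def powr_powr)
  have "integrable M (\<lambda>\<omega>. exp ((t * \<bar>X \<omega>\<bar>) powr (1 / \<theta>)))
      \<and> expectation (\<lambda>\<omega>. exp ((t * \<bar>X \<omega>\<bar>) powr (1 / \<theta>))) \<le> exp ((t * K) powr (1 / \<theta>))"
    if t: "0 < t" "t \<le> 1 / K" for t
  proof -
    define r where "r = t powr (1 / \<theta>)"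
    have "r \<le> (1 / K) powr (1 / \<theta>)"
      unfolding r_def using t \<theta> by (intro powr_mono2) auto
    also have "\<dots> = 1 / c"
      using K by (simp add: powr_divide)
    also have "\<dots> \<le> s"
      using c s by (simp add: field_simps)
    finally have r: "0 \<le> r" "r \<le> s"
      by (auto simp: r_def)
    have scale: "(t * z) powr (1 / \<theta>) = r * z powr (1 / \<theta>)" if "z \<ge> 0" for z
      using t that by (simp add: r_def powr_mult)
    note jensen = integral_exp_scaled_le[OF _ r s int]
    have "exp (r * d) \<le> exp (r * c)"
      using r c by (simp add: mult_left_mono)
    then have "expectation (\<lambda>\<omega>. exp (r * \<bar>X \<omega>\<bar> powr (1 / \<theta>))) \<le> exp (r * c)"
      using order_trans[OF jensen(2)] by (simp add: d_def)
    then show ?thesis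
      using jensen(1) t K by (simp add: scale r_def[symmetric] powr_mult)
  qed
  then show ?thesis
    unfolding mgf_bound_near_zero_def using K(1) by blast
qed

lemma mgf_bound_near_zero_imp_at_point:
  assumes \<theta>: "\<theta> > 0" and "mgf_bound_near_zero M X \<theta>"
  shows "mgf_bound_at_point M X \<theta>"
proof -
  obtain K where K: "K > 0" and mgf: "\<And>t. 0 < t \<Longrightarrow> t \<le> 1 / K \<Longrightarrow>
      integrable M (\<lambda>\<omega>. exp ((t * \<bar>X \<omega>\<bar>) powr (1 / \<theta>))) \<and>
      (\<integral>\<omega>. exp ((t * \<bar>X \<omega>\<bar>) powr (1 / \<theta>)) \<partial>M) \<le> exp ((t * K) powr (1 / \<theta>))"
    using assms(2) unfolding mgf_bound_near_zero_def by blast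
  \<comment> \<open>Here \<open>t * K\<close> is the number whose power \<open>1 / \<theta>\<close> is \<open>1 / 2\<close>, and \<open>exp (1 / 2) \<le> 2\<close>.\<close>
  define t where "t = (1 / 2) powr \<theta> / K"
  have "(1 / 2) powr \<theta> \<le> (1 / 2) powr (0::real)"
    using \<theta> by (intro powr_mono') auto
  then have t: "0 < t" "t \<le> 1 / K"
    using K by (auto simp: t_def divide_right_mono)
  have "(t * K) powr (1 / \<theta>) = 1 / 2"
    using K \<theta> by (simp add: t_def powr_powr)
  then have "(\<integral>\<omega>. exp ((t * \<bar>X \<omega>\<bar>) powr (1 / \<theta>)) \<partial>M) \<le> 2"
    using mgf[OF t] exp_half_le2 by (metis order_trans)
  moreover have "integrable M (\<lambda>\<omega>. exp ((t * \<bar>X \<omega>\<bar>) powr (1 / \<theta>)))"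
    using mgf[OF t] by blast
  ultimately show ?thesis
    unfolding mgf_bound_at_point_def using t by (intro exI[of _ "1 / t"]) (simp add: mult.commute)
qed

lemma mgf_bound_at_point_imp_exp_moment:
  assumes "mgf_bound_at_point M X \<theta>"
  shows "exp_moment M X \<theta>"
proof -
  obtain K where K: "K > 0" and int: "integrable M (\<lambda>\<omega>. exp ((\<bar>X \<omega>\<bar> / K) powr (1 / \<theta>)))"
    using assms unfolding mgf_bound_at_point_def by blast
  have "(\<bar>X \<omega>\<bar> / K) powr (1 / \<theta>) = (1 / K) powr (1 / \<theta>) * \<bar>X \<omega>\<bar> powr (1 / \<theta>)" for \<omega>
    using K by (simp add: powr_divide)
  then show ?thesis
    unfolding exp_moment_def using int K by (intro exI[of _ "(1 / K) powr (1 / \<theta>)"]) simp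
qed

theorem theorem2p1:
  fixes M :: "'a measure" and X :: "'a \<Rightarrow> real" and \<theta> :: real
  assumes "prob_space M"
    and "X \<in> borel_measurable M"
    and "\<theta> > 0"
  shows "(tail_bound M X \<theta> \<longleftrightarrow> moment_bound M X \<theta>) \<and>
         (moment_bound M X \<theta> \<longleftrightarrow> mgf_bound_near_zero M X \<theta>) \<and>
         (mgf_bound_near_zero M X \<theta> \<longleftrightarrow> mgf_bound_at_point M X \<theta>)"
  using tail_bound_imp_exp_moment[OF assms] exp_moment_imp_moment_bound[OF assms]
    moment_bound_imp_tail_bound[OF assms] exp_moment_imp_mgf_bound_near_zero[OF assms]
    mgf_bound_near_zero_imp_at_point[OF assms(3)] mgf_bound_at_point_imp_exp_moment
  by blast

end
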